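(* Let $a<0<b$ and let $f,g:[a,b]\to[0,\infty)$ be concave functions with $f(a)=f(b)=g(a)=g(b)=0$, $\max_{[a,b]}f=f(0)$ and $\max_{[a,b]}g=g(0)$. Let $C=\{(x,y)\in[a,b]\times\mathbb{R}:-g(x)\le y\le f(x)\}$. Then $$P_{\gamma_2}(C)=\frac{1}{2\pi}\int_{\partial C}\exp\left(-\frac{x^2+y^2}{2}\right)d\mathcal{H}^1\le\frac{2}{\sqrt{\pi}}.$$
   Context: For a convex set $\Omega\subset\mathbb{R}^2$, its Gaussian perimeter is $P_{\gamma_2}(\Omega)=\frac{1}{2\pi}\int_{\partial\Omega}\exp\left(-\frac{|\mathbf{x}|^2}{2}\right)d\mathcal{H}^1(\mathbf{x})$, where $\mathcal{H}^1$ is the one-dimensional Hausdorff measure. (The paper writes the condition on $g$ as "$\min_{[a,b]} g = g(0)$", which would force $g\equiv 0$; the intended condition, used in the proof, is that $g$ attains its maximum at $0$.) *)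

theory Defs
  imports "HOL-Analysis.Analysis"
begin

text \<open>One-dimensional Hausdorff (outer) measure via the Caratheodory construction,
  normalised so that it coincides with length (covers by countably many bounded sets).\<close>

definition hausdorff1_delta :: "real \<Rightarrow> 'a::metric_space set \<Rightarrow> ennreal" where
  "hausdorff1_delta \<delta> A =
     (INF E \<in> {E :: nat \<Rightarrow> 'a set. A \<subseteq> (\<Union>i. E i) \<and>
                 (\<forall>i. bounded (E i) \<and> diameter (E i) \<le> \<delta>)}.
        (\<Sum>i. ennreal (diameter (E i))))"

definition hausdorff1_outer :: "'a::metric_space set \<Rightarrow> ennreal" where
  "hausdorff1_outer A = (SUP \<delta> \<in> {0<..}. hausdorff1_delta \<delta> A)"

definition hausdorff1 :: "'a::metric_space measure" where
  "hausdorff1 = measure_of UNIV (sets borel) hausdorff1_outer"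

definition gaussian_perimeter2 :: "(real \<times> real) set \<Rightarrow> ennreal" where
  "gaussian_perimeter2 \<Omega> =
     ennreal (1 / (2 * pi)) *
       (\<integral>\<^sup>+ x \<in> frontier \<Omega>. ennreal (exp (- (norm x)\<^sup>2 / 2)) \<partial>hausdorff1)"

end

theory Submission
  imports Defs "HOL-Probability.Distributions"
begin

text \<open>
  The coordinate axes cut the boundary into four monotone arcs, and each contributes at most
  \<open>sqrt pi\<close> to the integral. On a descending arc in the first quadrant the map \<open>(x, y) \<mapsto> x - y\<close>
  does not decrease distances, so the Hausdorff integral over the arc is bounded by a Lebesgue
  integral in \<open>s = x - y\<close>. By concavity the arc lies above the chord joining its end points
  \<open>(0, h)\<close> and \<open>(b, 0)\<close>, so the weight, written in \<open>s\<close>, only grows when the arc is replaced by the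
  chord. This leaves a one-dimensional Gaussian integral depending on \<open>h\<close> and \<open>b\<close>, which stays below
  \<open>sqrt pi\<close> with room to spare.
\<close>

text \<open>Gaussian length is not monotone under inclusion of convex sets, so an arc cannot simply
  be traded for its chord. Measuring by \<open>s = x - y\<close> charges \<open>|dx| + |dy|\<close>
  instead of length, a loss of at most a factor \<open>sqrt 2\<close>, but it makes every descending
  arc from \<open>(0, h)\<close> to \<open>(b, 0)\<close> a graph over the same interval
  \<open>{- h..b}\<close>. Only the weights then remain to be compared, point by point. The
  one-variable estimate needs two regimes. For comparable \<open>h\<close> and \<open>b\<close> the
  Gaussian is dominated by a multiple of the inverse distance to the origin, whose integral is a
  logarithm that blows up as \<open>h / b\<close> tends to 0. For \<open>h\<close> much smaller than
  \<open>b\<close>, half a Gaussian measured from the foot of the perpendicular is close to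
  \<open>sqrt (pi / 2)\<close>, but at \<open>h = b\<close> that bound already spends all of
  \<open>sqrt pi\<close> on the right part alone. At ratio 4 both methods still succeed.\<close>

section \<open>Integration against the Hausdorff measure\<close>

text \<open>This holds whether or not the outer measure is countably additive on the Borel sets:
  if it were not, \<^const>\<open>measure_of\<close> would return the zero measure.\<close>

lemma emeasure_hausdorff1_le: "emeasure hausdorff1 A \<le> hausdorff1_outer A"
  unfolding hausdorff1_def emeasure_measure_of_conv by auto

lemma sets_hausdorff1 [measurable_cong, simp]: "sets hausdorff1 = sets borel"
  unfolding hausdorff1_def by (metis sets.sigma_sets_eq sets_measure_of space_borel subset_Pow_Union sets.space_closed)

text \<open>Cutting the parameter interval into \<open>N\<close> equal pieces and pulling them back
  along \<open>T\<close> covers \<open>A\<close>. Since \<open>T\<close> does not shrink distances,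
  each piece has diameter at most the step, and the steps add up to \<beta> - \<alpha> however fine
  the partition is.\<close>

lemma hausdorff1_outer_le_expansive:
  fixes A :: "'a::real_normed_vector set" and T :: "'a \<Rightarrow> real"
  assumes "\<alpha> \<le> \<beta>" and T: "T ` A \<subseteq> {\<alpha>..\<beta>}"
    and exp: "\<And>p q. p \<in> A \<Longrightarrow> q \<in> A \<Longrightarrow> dist p q \<le> \<bar>T p - T q\<bar>"
  shows "hausdorff1_outer A \<le> ennreal (\<beta> - \<alpha>)"
  unfolding hausdorff1_outer_def
proof (rule SUP_least)
  fix \<delta> :: real assume "\<delta> \<in> {0<..}"
  then have "\<delta> > 0" by simp
  obtain N :: nat where N: "(\<beta> - \<alpha>) / \<delta> < real N" using reals_Archimedean2 by blast
  have "N > 0" using N assms(1) \<open>\<delta> > 0\<close> by (metis divide_nonneg_pos diff_ge_0_iff_ge gr0I not_less of_nat_0)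
  define \<Delta> where "\<Delta> = (\<beta> - \<alpha>) / N"
  have "\<Delta> \<ge> 0" using assms(1) by (simp add: \<Delta>_def)
  have "\<Delta> \<le> \<delta>" using N \<open>\<delta> > 0\<close> \<open>N > 0\<close> by (simp add: \<Delta>_def field_simps)
  have N\<Delta>: "N * \<Delta> = \<beta> - \<alpha>" using \<open>N > 0\<close> by (simp add: \<Delta>_def)
  define E where "E i = (if i < N then {p \<in> A. \<alpha> + i * \<Delta> \<le> T p \<and> T p \<le> \<alpha> + (i + 1) * \<Delta>} else {})" for i :: nat
  have dist_E: "dist p q \<le> \<Delta>" if "p \<in> E i" "q \<in> E i" for p q i
  proof -
    have "dist p q \<le> \<bar>T p - T q\<bar>" using that exp by (auto simp: E_def split: if_splits)
    also have "\<dots> \<le> \<Delta>" using that by (auto simp: E_def algebra_simps split: if_splits)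
    finally show ?thesis .
  qed
  have bE: "bounded (E i)" for i
    unfolding bounded_two_points using dist_E by blast
  have dE: "diameter (E i) \<le> \<Delta>" for i
    by (rule diameter_le) (use dist_E \<open>\<Delta> \<ge> 0\<close> in \<open>auto simp: dist_norm\<close>)
  have cover: "A \<subseteq> (\<Union>i. E i)"
  proof
    fix p assume p: "p \<in> A"
    show "p \<in> (\<Union>i. E i)"
    \<comment> \<open>The right end point is treated apart: the floor below would give index
      \<open>N\<close>, one past the last piece. This also absorbs the degenerate case of step
      0.\<close>
    proof (cases "T p < \<beta>")
      case False
      then have "T p = \<beta>" using T p by fastforce
      moreover have "real (N - 1) + 1 = N" using \<open>N > 0\<close> by simp
      ultimately have "p \<in> E (N - 1)" using p \<open>N > 0\<close> N\<Delta> \<open>\<Delta> \<ge> 0\<close>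
        by (simp add: E_def algebra_simps)
      then show ?thesis by blast
    next
      case True
      then have lt: "T p - \<alpha> < N * \<Delta>" using N\<Delta> by simp
      have "\<Delta> > 0" using True T p \<open>N > 0\<close> unfolding \<Delta>_def by fastforce
      define i where "i = nat \<lfloor>(T p - \<alpha>) / \<Delta>\<rfloor>"
      have "0 \<le> (T p - \<alpha>) / \<Delta>" using T p \<open>\<Delta> > 0\<close> by fastforce
      then have i: "real i \<le> (T p - \<alpha>) / \<Delta>" "(T p - \<alpha>) / \<Delta> < real i + 1"
        unfolding i_def by linarith+
      then have "real i * \<Delta> \<le> T p - \<alpha>" "T p - \<alpha> < (real i + 1) * \<Delta>"
        using \<open>\<Delta> > 0\<close> by (simp_all add: field_simps)
      moreover have "i < N"
        using i lt \<open>\<Delta> > 0\<close> by (metis calculation(1) le_less_trans mult_less_cancel_right_pos of_nat_less_iff)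
      ultimately have "p \<in> E i" using p by (simp add: E_def algebra_simps)
      then show ?thesis by blast
    qed
  qed
  have "hausdorff1_delta \<delta> A \<le> (\<Sum>i. ennreal (diameter (E i)))"
    unfolding hausdorff1_delta_def
    by (rule INF_lower) (use cover bE order_trans[OF dE \<open>\<Delta> \<le> \<delta>\<close>] in auto)
  \<comment> \<open>From index \<open>N\<close> on the sets are empty, and
    \<open>diameter {}\<close> is 0 by definition.\<close>
  also have "\<dots> = (\<Sum>i<N. ennreal (diameter (E i)))"
    by (rule suminf_finite) (auto simp: E_def diameter_def)
  also have "\<dots> \<le> (\<Sum>i<N. ennreal \<Delta>)"
    by (intro sum_mono ennreal_leI dE)
  also have "\<dots> = ennreal (\<beta> - \<alpha>)"
    using \<open>\<Delta> \<ge> 0\<close> by (simp add: N\<Delta>[symmetric] ennreal_mult ennreal_of_nat_eq_real_of_nat)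
  finally show "hausdorff1_delta \<delta> A \<le> ennreal (\<beta> - \<alpha>)" .
qed

lemma integral_uniform_partition:
  fixes \<psi> :: "real \<Rightarrow> real" and n :: nat and \<alpha> \<Delta> :: real
  assumes "continuous_on {\<alpha>..\<alpha> + n * \<Delta>} \<psi>" "0 \<le> \<Delta>"
  shows "(\<Sum>j<n. integral {\<alpha> + j * \<Delta>..\<alpha> + (j + 1) * \<Delta>} \<psi>) = integral {\<alpha>..\<alpha> + n * \<Delta>} \<psi>"
  using assms(1)
proof (induction n)
  case (Suc n)
  have le: "\<alpha> + n * \<Delta> \<le> \<alpha> + Suc n * \<Delta>" "\<alpha> \<le> \<alpha> + n * \<Delta>"
    using assms(2) by (auto simp: algebra_simps)
  have "integral {\<alpha>..\<alpha> + n * \<Delta>} \<psi> + integral {\<alpha> + n * \<Delta>..\<alpha> + Suc n * \<Delta>} \<psi> = integral {\<alpha>..\<alpha> + Suc n * \<Delta>} \<psi>"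
    using le by (intro Henstock_Kurzweil_Integration.integral_combine integrable_continuous_interval Suc.prems)
  moreover have "continuous_on {\<alpha>..\<alpha> + n * \<Delta>} \<psi>"
    using Suc.prems by (rule continuous_on_subset) (use le in auto)
  ultimately show ?case using Suc.IH by (simp add: add.commute)
qed simp

text \<open>Upper Riemann sums for a partition of \<open>{\<alpha>..\<beta>}\<close>, pulled back to \<open>A\<close> along \<open>T\<close>.\<close>

lemma nn_integral_hausdorff1_le_integral:
  fixes A :: "'a::real_normed_vector set" and T :: "'a \<Rightarrow> real"
  assumes A: "A \<in> sets borel" and T: "T \<in> borel_measurable borel"
    and le: "\<alpha> \<le> \<beta>" and TA: "T ` A \<subseteq> {\<alpha>..\<beta>}"
    and exp: "\<And>p q. p \<in> A \<Longrightarrow> q \<in> A \<Longrightarrow> dist p q \<le> \<bar>T p - T q\<bar>"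
    and \<psi>: "continuous_on {\<alpha>..\<beta>} \<psi>" "\<And>t. t \<in> {\<alpha>..\<beta>} \<Longrightarrow> 0 \<le> \<psi> t"
    and \<phi>: "\<And>p. p \<in> A \<Longrightarrow> \<phi> p \<le> \<psi> (T p)"
  shows "(\<integral>\<^sup>+ p \<in> A. ennreal (\<phi> p) \<partial>hausdorff1) \<le> ennreal (integral {\<alpha>..\<beta>} \<psi>)"
proof -
  \<comment> \<open>The factor 2 collects two errors: one for bounding \<psi> on a piece by its left
    value plus \<epsilon>, one for comparing that left value with the integral over the
    piece.\<close>
  have "(\<integral>\<^sup>+ p \<in> A. ennreal (\<phi> p) \<partial>hausdorff1) \<le> ennreal (integral {\<alpha>..\<beta>} \<psi> + 2 * \<epsilon> * (\<beta> - \<alpha>))"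
    if "\<epsilon> > 0" for \<epsilon> :: real
  proof -
    have "uniformly_continuous_on {\<alpha>..\<beta>} \<psi>"
      using \<psi>(1) compact_uniformly_continuous by blast
    then obtain \<delta> where "\<delta> > 0"
      and \<delta>: "\<And>s t. s \<in> {\<alpha>..\<beta>} \<Longrightarrow> t \<in> {\<alpha>..\<beta>} \<Longrightarrow> dist t s < \<delta> \<Longrightarrow> dist (\<psi> t) (\<psi> s) < \<epsilon>"
      using \<open>\<epsilon> > 0\<close> unfolding uniformly_continuous_on_def by metis
    obtain n :: nat where n: "(\<beta> - \<alpha>) / \<delta> < real n" using reals_Archimedean2 by blast
    have "n > 0" using n le \<open>\<delta> > 0\<close> by (metis divide_nonneg_pos diff_ge_0_iff_ge gr0I not_less of_nat_0)
    define \<Delta> where "\<Delta> = (\<beta> - \<alpha>) / n"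
    have "\<Delta> \<ge> 0" using le by (simp add: \<Delta>_def)
    have "\<Delta> < \<delta>" using n \<open>\<delta> > 0\<close> \<open>n > 0\<close> by (simp add: \<Delta>_def field_simps)
    have n\<Delta>: "\<beta> = \<alpha> + n * \<Delta>" using \<open>n > 0\<close> by (simp add: \<Delta>_def)
    define t where "t j = \<alpha> + real j * \<Delta>" for j
    have t_in: "{t j..t (Suc j)} \<subseteq> {\<alpha>..\<beta>}" if "j < n" for j
    proof -
      have "real (Suc j) * \<Delta> \<le> n * \<Delta>" using that \<open>\<Delta> \<ge> 0\<close> by (intro mult_right_mono) auto
      then show ?thesis using \<open>\<Delta> \<ge> 0\<close> by (auto simp: t_def n\<Delta>)
    qed
    have t_step: "t (Suc j) = t j + \<Delta>" for j by (simp add: t_def algebra_simps)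
    \<comment> \<open>These closed pieces overlap at the grid points, which is harmless for an upper
      bound.\<close>
    define B where "B j = A \<inter> T -` {t j..t (Suc j)}" for j
    have B_meas: "B j \<in> sets borel" for j
      unfolding B_def using A measurable_sets[OF T, of "{t j..t (Suc j)}"] by auto
    have close: "\<bar>\<psi> s - \<psi> (t j)\<bar> < \<epsilon>" if "j < n" "s \<in> {t j..t (Suc j)}" for j s
    proof -
      have "t j \<in> {t j..t (Suc j)}" using t_step \<open>\<Delta> \<ge> 0\<close> by simp
      then show ?thesis
        using \<delta>[of "t j" s] t_in[OF that(1)] that(2) t_step[of j] \<open>\<Delta> < \<delta>\<close>
        by (auto simp: dist_real_def)
    qed
    have cover: "\<exists>j<n. p \<in> B j" if "p \<in> A" for p
    proof -
      have p: "\<alpha> \<le> T p" "T p \<le> t n" using TA that n\<Delta> by (auto simp: t_def)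
      define j where "j = (LEAST j. T p \<le> t (Suc j))"
      obtain n' where n': "n = Suc n'" using \<open>n > 0\<close> gr0_implies_Suc by blast
      have "T p \<le> t (Suc j)" "j \<le> n'"
        unfolding j_def using p n' by (metis LeastI, metis Least_le)
      moreover have "t j \<le> T p"
      proof (cases j)
        case (Suc i)
        then have "\<not> T p \<le> t (Suc i)" using not_less_Least[of i "\<lambda>j. T p \<le> t (Suc j)"] unfolding j_def by simp
        then show ?thesis using Suc by simp
      qed (use p in \<open>simp add: t_def\<close>)
      ultimately show ?thesis using that n' by (auto simp: B_def less_Suc_eq_le)
    qed
    have outer: "emeasure hausdorff1 (B j) \<le> ennreal \<Delta>" for j
    proof -
      have "hausdorff1_outer (B j) \<le> ennreal (t (Suc j) - t j)"
        using exp \<open>\<Delta> \<ge> 0\<close>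
        by (intro hausdorff1_outer_le_expansive[where T = T]) (auto simp: B_def t_step)
      then show ?thesis using emeasure_hausdorff1_le[of "B j"] by (simp add: t_step)
    qed
    have nonneg: "0 \<le> \<psi> (t j) + \<epsilon>" if "j < n" for j
      using \<psi>(2)[of "t j"] t_in[OF that] t_step[of j] \<open>\<Delta> \<ge> 0\<close> \<open>\<epsilon> > 0\<close> by auto
    have "(\<integral>\<^sup>+ p \<in> A. ennreal (\<phi> p) \<partial>hausdorff1)
        \<le> (\<integral>\<^sup>+ p. (\<Sum>j<n. ennreal (\<psi> (t j) + \<epsilon>) * indicator (B j) p) \<partial>hausdorff1)"
    proof (rule nn_integral_mono)
      fix p :: 'a
      show "ennreal (\<phi> p) * indicator A p \<le> (\<Sum>j<n. ennreal (\<psi> (t j) + \<epsilon>) * indicator (B j) p)"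
      proof (cases "p \<in> A")
        case True
        then obtain j where j: "j < n" "p \<in> B j" using cover by blast
        have "\<phi> p \<le> \<psi> (t j) + \<epsilon>"
          using \<phi>[OF True] close[OF j(1), of "T p"] j(2) by (auto simp: B_def)
        then have "ennreal (\<phi> p) * indicator A p \<le> ennreal (\<psi> (t j) + \<epsilon>) * indicator (B j) p"
          using j True by (simp add: ennreal_leI)
        also have "\<dots> \<le> (\<Sum>j<n. ennreal (\<psi> (t j) + \<epsilon>) * indicator (B j) p)"
          using j(1) by (intro member_le_sum) auto
        finally show ?thesis .
      qed simp
    qed
    also have "\<dots> = (\<Sum>j<n. ennreal (\<psi> (t j) + \<epsilon>) * emeasure hausdorff1 (B j))"
      using B_meas by (subst nn_integral_sum) (auto simp: nn_integral_cmult_indicator)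
    also have "\<dots> \<le> (\<Sum>j<n. ennreal (\<psi> (t j) + \<epsilon>) * ennreal \<Delta>)"
      by (intro sum_mono mult_left_mono outer) auto
    also have "\<dots> = ennreal (\<Sum>j<n. (\<psi> (t j) + \<epsilon>) * \<Delta>)"
      using nonneg \<open>\<Delta> \<ge> 0\<close> by (subst sum_ennreal[symmetric]) (auto simp: ennreal_mult)
    also have "\<dots> \<le> ennreal (\<Sum>j<n. integral {t j..t (Suc j)} \<psi> + 2 * \<epsilon> * \<Delta>)"
    proof (intro ennreal_leI sum_mono)
      fix j assume "j \<in> {..<n}"
      then have j: "j < n" by simp
      have int: "\<psi> integrable_on {t j..t (Suc j)}"
        using continuous_on_subset[OF \<psi>(1) t_in[OF j]] by (rule integrable_continuous_interval)
      have "integral {t j..t (Suc j)} (\<lambda>_. \<psi> (t j) - \<epsilon>) \<le> integral {t j..t (Suc j)} \<psi>"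
      proof (rule integral_le)
        fix s assume "s \<in> {t j..t (Suc j)}"
        then show "\<psi> (t j) - \<epsilon> \<le> \<psi> s" using close[OF j] by fastforce
      qed (use int in auto)
      then have "(\<psi> (t j) - \<epsilon>) * \<Delta> \<le> integral {t j..t (Suc j)} \<psi>"
        using t_step[of j] \<open>\<Delta> \<ge> 0\<close> by (simp add: mult.commute)
      then show "(\<psi> (t j) + \<epsilon>) * \<Delta> \<le> integral {t j..t (Suc j)} \<psi> + 2 * \<epsilon> * \<Delta>"
        by (simp add: algebra_simps)
    qed
    also have "(\<Sum>j<n. integral {t j..t (Suc j)} \<psi> + 2 * \<epsilon> * \<Delta>) = integral {\<alpha>..\<beta>} \<psi> + 2 * \<epsilon> * (\<beta> - \<alpha>)"
      using integral_uniform_partition[of \<alpha> n \<Delta> \<psi>] \<psi>(1) \<open>\<Delta> \<ge> 0\<close> n\<Delta>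
      by (simp add: sum.distrib t_def add.commute)
    finally show ?thesis .
  qed
  note * = this
  have lim: "((\<lambda>\<epsilon>. ennreal (integral {\<alpha>..\<beta>} \<psi> + 2 * \<epsilon> * (\<beta> - \<alpha>))) \<longlongrightarrow> ennreal (integral {\<alpha>..\<beta>} \<psi> + 2 * 0 * (\<beta> - \<alpha>))) (at_right 0)"
    by (intro tendsto_ennrealI tendsto_intros)
  have "(\<integral>\<^sup>+ p \<in> A. ennreal (\<phi> p) \<partial>hausdorff1) \<le> ennreal (integral {\<alpha>..\<beta>} \<psi> + 2 * 0 * (\<beta> - \<alpha>))"
    by (rule tendsto_lowerbound[OF lim]) (use * in \<open>auto simp: eventually_at_right_less intro: eventually_mono[OF eventually_at_right_less]\<close>)
  then show ?thesis by simp
qed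

section \<open>The Gaussian weight of a chord\<close>

text \<open>In the coordinates \<open>s = x - y\<close>, \<open>u = x + y\<close> the segment from \<open>(0, h)\<close> to \<open>(b, 0)\<close>
  is the graph \<open>u = chord h b s\<close>, and \<open>x\<^sup>2 + y\<^sup>2 = (s\<^sup>2 + u\<^sup>2) / 2\<close>.\<close>

definition chord :: "real \<Rightarrow> real \<Rightarrow> real \<Rightarrow> real" where
  "chord h b s = (2 * h * b + (b - h) * s) / (b + h)"

definition chord_weight :: "real \<Rightarrow> real \<Rightarrow> real \<Rightarrow> real" where
  "chord_weight h b s = exp (- (s\<^sup>2 + (chord h b s)\<^sup>2) / 4)"

lemma continuous_on_chord_weight: "continuous_on S (chord_weight h b)"
  unfolding chord_weight_def chord_def divide_inverse by (intro continuous_intros)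

text \<open>The substitution \<open>c * (s + d)\<close> starts at the peak, so the integral is
  \<open>1 / c\<close> times an initial part of the half-line integral
  \<open>sqrt pi / 2\<close>.\<close>

lemma integral_half_gaussian_le:
  fixes c d :: real
  assumes "0 < c" "- d \<le> v"
  shows "integral {- d..v} (\<lambda>s. exp (- (c * (s + d))\<^sup>2)) \<le> sqrt pi / (2 * c)"
proof -
  let ?g = "\<lambda>x::real. exp (- x\<^sup>2)"
  define w where "w = c * (v + d)"
  have "((\<lambda>x. indicator {0..} x *\<^sub>R ?g x) has_integral sqrt pi / 2) UNIV"
    using gaussian_moment_0 has_integral_integral_lborel has_bochner_integral_iff by metis
  then have half: "(?g has_integral sqrt pi / 2) {0..}"
    by (subst has_integral_restrict_UNIV[symmetric])
       (simp add: indicator_def of_bool_def if_distrib[of "\<lambda>u. u * _"] cong: if_cong)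
  have int: "(?g has_integral integral {0..w} ?g) (cbox 0 w)"
    unfolding box_real by (intro integrable_integral integrable_continuous_interval continuous_intros)
  have "((\<lambda>s. exp (- (c * (s + d))\<^sup>2)) has_integral integral {0..w} ?g / c) {- d..v}"
  proof -
    have ends: "(w - c * d) /\<^sub>R c = v" "(0 - c * d) /\<^sub>R c = - d"
      using assms(1) by (simp_all add: w_def divide_inverse_commute[symmetric] field_simps)
    show ?thesis
      using has_integral_affinity'[OF int assms(1), of "c * d", unfolded ends]
      by (simp add: distrib_left divide_inverse_commute)
  qed
  then have "integral {- d..v} (\<lambda>s. exp (- (c * (s + d))\<^sup>2)) = integral {0..w} ?g / c"
    by (rule integral_unique)
  moreover have "integral {0..w} ?g \<le> sqrt pi / 2"
    using half by (intro has_integral_subset_le[OF _ _ half, of "{0..w}"] integrable_integral integrable_continuous_interval continuous_intros) auto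
  ultimately show ?thesis using assms(1) by (simp add: field_simps)
qed

text \<open>The left side is convex and vanishes at 0, so it lies below its chord over
  \<open>{0..5/6}\<close>, of slope \<open>6/5 * ln 11\<close>. With \<open>ln 11\<close> at most
  2.4 the slope is at most 2.88; the rounded 2.9 still lies below \<open>sqrt (pi * exp 1)\<close>,
  which is what the final estimate requires.\<close>

lemma ln_ratio_le:
  fixes y :: real
  assumes "0 < y" "y \<le> 5/6"
  shows "ln ((1 + y) / (1 - y)) \<le> 2.9 * y"
proof -
  have ln11: "ln 11 \<le> (2.4::real)"
  proof -
    have e: "exp 1 \<ge> (2.718 :: real)" using e_approx_32 by (simp add: abs_if split: if_splits)
    \<comment> \<open>Writing 2.4 as 24/10 turns the claim into a comparison of
      \<open>11 ^ 10\<close> with \<open>exp 24\<close>, settled by a rational lower bound for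
      \<open>exp 1\<close>.\<close>
    have "ln (11 ^ 10 :: real) \<le> ln (2.718 ^ 24)"
      by (subst ln_le_cancel_iff) (simp_all add: power_divide)
    also have "\<dots> \<le> 24 * ln (exp 1)"
      using e by (subst ln_realpow) (auto simp del: ln_exp)
    finally have "ln (11 ^ 10 :: real) \<le> 24" by simp
    moreover have "ln (11 ^ 10 :: real) = 10 * ln 11" by (subst ln_realpow) auto
    ultimately show ?thesis by linarith
  qed
  define D where "D x = ln (1 + x) - ln (1 - x)" for x :: real
  have "convex_on {0..5/6} D"
  proof (rule f''_ge0_imp_convex)
    show "DERIV D x :> 1 / (1 + x) + 1 / (1 - x)" if "x \<in> {0..5/6}" for x
      unfolding D_def using that
      by (intro DERIV_cong[OF DERIV_diff[OF DERIV_chain2[OF DERIV_ln_divide] DERIV_chain2[OF DERIV_ln_divide]]])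
         (auto intro!: derivative_eq_intros)
    show "DERIV (\<lambda>x. 1 / (1 + x) + 1 / (1 - x)) x :> 1 / (1 - x)\<^sup>2 - 1 / (1 + x)\<^sup>2" if "x \<in> {0..5/6}" for x :: real
      using that by (auto intro!: derivative_eq_intros simp: power2_eq_square)
    show "1 / (1 - x)\<^sup>2 - 1 / (1 + x)\<^sup>2 \<ge> 0" if "x \<in> {0..5/6}" for x :: real
    proof -
      have "(1 - x)\<^sup>2 \<le> (1 + x)\<^sup>2" using that by (intro power_mono) auto
      moreover have "0 < (1 - x)\<^sup>2" using that by simp
      ultimately show ?thesis by (simp add: frac_le)
    qed
  qed simp
  from convex_onD[OF this, of "6/5 * y" 0 "5/6"] assms
  have "D y \<le> (6/5 * y) * D (5/6)" by (simp add: D_def)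
  also have "D (5/6) = ln 11"
    unfolding D_def using ln_div[of "1 + 5/6" "1 - 5/6 :: real"] by simp
  also have "6/5 * y * ln 11 \<le> 6/5 * y * 2.4" using ln11 assms by (intro mult_left_mono) auto
  also have "\<dots> \<le> 2.9 * y" using assms by simp
  finally show ?thesis unfolding D_def using assms by (simp add: ln_div)
qed

text \<open>This is the square root of \<open>t \<le> exp (t - 1)\<close> at
  \<open>t = Q / 2\<close>, with equality at \<open>Q = 2\<close>. The right side is homogeneous, so
  its integral along a chord depends only on the ratio of \<open>h\<close> and
  \<open>b\<close>.\<close>

lemma exp_minus_quarter_le:
  fixes Q :: real
  assumes "0 < Q"
  shows "exp (- Q / 4) \<le> sqrt (2 / exp 1) / sqrt Q"
proof -
  have "Q / 2 \<le> exp (Q / 2) / exp 1" using exp_ge_add_one_self[of "Q / 2 - 1"] by (simp add: exp_diff)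
  then have "1 / exp (Q / 2) \<le> 2 / (exp 1 * Q)"
    using assms by (simp add: divide_simps mult.commute)
  then have "sqrt (exp (- (Q / 2))) \<le> sqrt (2 / (exp 1 * Q))" by (simp add: exp_minus inverse_eq_divide)
  moreover have "sqrt (exp (- (Q / 2))) = exp (- Q / 4)"
    by (rule real_sqrt_unique) (simp_all flip: exp_double)
  ultimately show ?thesis by (simp add: real_sqrt_divide real_sqrt_mult)
qed

text \<open>Half the derivative of the quadratic is \<open>M\<^sup>2 * s + m * k\<close>, so
  \<open>ln (L s) / M\<close> is the classical antiderivative: the derivative of \<open>L\<close> is
  \<open>M * L\<close> divided by the square root.\<close>

lemma has_integral_inverse_sqrt_quadratic:
  fixes m k :: real
  assumes "k \<noteq> 0" "u \<le> v"
  defines "M \<equiv> sqrt (1 + m\<^sup>2)"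
  defines "L \<equiv> \<lambda>s. M\<^sup>2 * s + m * k + M * sqrt (s\<^sup>2 + (k + m * s)\<^sup>2)"
  shows "((\<lambda>s. 1 / sqrt (s\<^sup>2 + (k + m * s)\<^sup>2)) has_integral (ln (L v / L u) / M)) {u..v}" "L v / L u > 0"
proof -
  have M: "M > 0" "M\<^sup>2 = 1 + m\<^sup>2" by (auto simp: M_def add_pos_nonneg)
  have Q: "s\<^sup>2 + (k + m * s)\<^sup>2 > 0" for s
    using assms(1) by (cases "s = 0") (auto simp: add_pos_nonneg)
  have L: "L s > 0" for s
  proof -
    \<comment> \<open>The two sides differ by exactly \<open>k\<^sup>2\<close>.\<close>
    have "(M\<^sup>2 * s + m * k)\<^sup>2 < M\<^sup>2 * (s\<^sup>2 + (k + m * s)\<^sup>2)"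
      using assms(1) unfolding M(2) by (simp add: algebra_simps power2_eq_square) (simp add: algebra_simps flip: power2_eq_square power_mult_distrib)
    then have "sqrt ((M\<^sup>2 * s + m * k)\<^sup>2) < sqrt (M\<^sup>2 * (s\<^sup>2 + (k + m * s)\<^sup>2))"
      by (subst real_sqrt_less_iff)
    then have "\<bar>M\<^sup>2 * s + m * k\<bar> < M * sqrt (s\<^sup>2 + (k + m * s)\<^sup>2)"
      using M(1) by (simp add: real_sqrt_mult)
    then show ?thesis unfolding L_def by linarith
  qed
  show "L v / L u > 0" using L by simp
  have "((\<lambda>s. 1 / sqrt (s\<^sup>2 + (k + m * s)\<^sup>2)) has_integral (ln (L v) / M - ln (L u) / M)) {u..v}"
  proof (rule fundamental_theorem_of_calculus[OF assms(2)])
    fix s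
    define R where "R = sqrt (s\<^sup>2 + (k + m * s)\<^sup>2)"
    have R: "R > 0" using Q[of s] by (simp add: R_def)
    have "DERIV (\<lambda>s. s\<^sup>2 + (k + m * s)\<^sup>2) s :> 2 * (s + (k + m * s) * m)"
      by (auto intro!: derivative_eq_intros)
    then have "DERIV (\<lambda>s. sqrt (s\<^sup>2 + (k + m * s)\<^sup>2)) s :> inverse R / 2 * (2 * (s + (k + m * s) * m))"
      unfolding R_def by (rule DERIV_chain2[where f = sqrt and x = s and g = "\<lambda>s. s\<^sup>2 + (k + m * s)\<^sup>2", OF DERIV_real_sqrt[OF Q]])
    also have "inverse R / 2 * (2 * (s + (k + m * s) * m)) = (s + (k + m * s) * m) / R"
      by (simp add: inverse_eq_divide del: distrib_left_numeral)
    finally have "DERIV (\<lambda>s. sqrt (s\<^sup>2 + (k + m * s)\<^sup>2)) s :> (s + (k + m * s) * m) / R" .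
    moreover have "DERIV (\<lambda>s. M\<^sup>2 * s + m * k) s :> M\<^sup>2"
      by (auto intro!: derivative_eq_intros)
    ultimately have "DERIV L s :> M\<^sup>2 + M * ((s + (k + m * s) * m) / R)"
      unfolding L_def by (intro DERIV_add DERIV_cmult)
    from DERIV_cdivide[OF DERIV_chain2[where f = ln and g = L and x = s, OF DERIV_ln_divide[OF L] this], of M]
    have "DERIV (\<lambda>s. ln (L s) / M) s :> 1 / L s * (M\<^sup>2 + M * ((s + (k + m * s) * m) / R)) / M" .
    also have "1 / L s * (M\<^sup>2 + M * ((s + (k + m * s) * m) / R)) / M = 1 / R"
    proof -
      have "(s + (k + m * s) * m) / R = (M\<^sup>2 * s + m * k) / R"
        unfolding M(2) by (simp add: field_simps power2_eq_square)
      moreover have "M\<^sup>2 + M * ((M\<^sup>2 * s + m * k) / R) = M * L s / R"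
        unfolding L_def R_def[symmetric] using R by (simp add: field_simps power2_eq_square)
      ultimately show ?thesis using L[of s] M(1) R by simp
    qed
    finally show "((\<lambda>s. ln (L s) / M) has_vector_derivative 1 / sqrt (s\<^sup>2 + (k + m * s)\<^sup>2)) (at s within {u..v})"
      unfolding R_def has_real_derivative_iff_has_vector_derivative by (rule has_vector_derivative_at_within)
  qed
  then show "((\<lambda>s. 1 / sqrt (s\<^sup>2 + (k + m * s)\<^sup>2)) has_integral (ln (L v / L u) / M)) {u..v}"
    using L[of u] L[of v] by (simp add: ln_div diff_divide_distrib)
qed

text \<open>For a small ratio \<open>h / b\<close> complete the square and split the interval at the point of the segment
  nearest to the origin; the right part is at most half a Gaussian.\<close>

lemma integral_chord_weight_steep:
  assumes "0 \<le> h" "0 < b" "4 * h \<le> b"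
  shows "integral {- h..b} (chord_weight h b) \<le> sqrt pi"
proof -
  define D where "D = h\<^sup>2 + b\<^sup>2"
  \<comment> \<open>At \<open>s = - d\<close> the chord's line is nearest to the origin,
    \<open>q\<close> is half its squared distance there, and \<open>c * (s + d)\<close> is the
    signed length along the line from that point, divided by \<open>sqrt 2\<close>. Thus
    \<open>square\<close> is Pythagoras.\<close>
  define d where "d = h * b * (b - h) / D"
  define c where "c = sqrt (D / 2) / (h + b)"
  define q where "q = h\<^sup>2 * b\<^sup>2 / (2 * D)"
  have D: "D > 0" "b\<^sup>2 \<le> D" using assms by (auto simp: D_def add_nonneg_pos)
  have hb: "h + b > 0" using assms by simp
  have c: "c > 0" "c\<^sup>2 = D / (2 * (h + b)\<^sup>2)"
    using D hb by (auto simp: c_def power_divide)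
  have "q \<ge> 0" using D by (simp add: q_def)
  have square: "(s\<^sup>2 + (chord h b s)\<^sup>2) / 4 = (c * (s + d))\<^sup>2 + q" for s
  proof -
    have "(s\<^sup>2 + (chord h b s)\<^sup>2) / 4 = ((h + b)\<^sup>2 * s\<^sup>2 + (2 * h * b + (b - h) * s)\<^sup>2) / (4 * (h + b)\<^sup>2)"
      using hb by (simp add: chord_def power_divide field_simps)
    also have "\<dots> = ((D * s + h * b * (b - h))\<^sup>2 + h\<^sup>2 * b\<^sup>2 * (h + b)\<^sup>2) / (2 * D * (h + b)\<^sup>2)"
    proof -
      have "((h + b)\<^sup>2 * s\<^sup>2 + (2 * h * b + (b - h) * s)\<^sup>2) * (2 * D) = 4 * ((D * s + h * b * (b - h))\<^sup>2 + h\<^sup>2 * b\<^sup>2 * (h + b)\<^sup>2)"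
        unfolding D_def by algebra
      then show ?thesis using D hb by (simp add: frac_eq_eq)
    qed
    also have "\<dots> = (c * (s + d))\<^sup>2 + q"
    proof -
      have "s + d = (D * s + h * b * (b - h)) / D" using D by (simp add: d_def field_simps)
      then have "(c * (s + d))\<^sup>2 = D / (2 * (h + b)\<^sup>2) * ((D * s + h * b * (b - h)) / D)\<^sup>2"
        by (simp only: power_mult_distrib c(2))
      also have "\<dots> = (D * s + h * b * (b - h))\<^sup>2 / (2 * D * (h + b)\<^sup>2)"
        using D by (simp add: power_divide power2_eq_square)
      finally show ?thesis using hb D by (simp add: q_def add_divide_distrib)
    qed
    finally show ?thesis .
  qed
  have weight: "chord_weight h b s = exp (- (c * (s + d))\<^sup>2) * exp (- q)" for s
    using square[of s] unfolding chord_weight_def by (simp add: minus_divide_left[symmetric] exp_add[symmetric])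
  have "0 \<le> d" using assms D by (simp add: d_def)
  have hd: "h - d = h\<^sup>2 * (h + b) / D"
    using D(1) by (simp add: d_def field_simps) (simp add: D_def power2_eq_square algebra_simps)
  then have "d \<le> h" using D assms by (smt (verit) divide_nonneg_pos mult_nonneg_nonneg zero_le_power2)
  have int: "chord_weight h b integrable_on {u..v}" for u v
    by (intro integrable_continuous_interval continuous_on_chord_weight)
  have "integral {- h..b} (chord_weight h b) = integral {- h..- d} (chord_weight h b) + integral {- d..b} (chord_weight h b)"
    using \<open>0 \<le> d\<close> \<open>d \<le> h\<close> assms int by (intro Henstock_Kurzweil_Integration.integral_combine[symmetric]) auto
  moreover have "integral {- h..- d} (chord_weight h b) \<le> 0.23"
  proof -
    have "integral {- h..- d} (chord_weight h b) \<le> integral {- h..- d} (\<lambda>_. exp (- q))"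
      by (intro integral_le int) (auto simp: weight)
    also have "\<dots> = (h - d) * exp (- q)" using \<open>d \<le> h\<close> by simp
    \<comment> \<open>The length \<open>h - d\<close> is unbounded, so the decay in \<open>q\<close>
      has to be kept; its first-order part suffices.\<close>
    also have "\<dots> \<le> (h - d) * (1 / (1 + q))"
      using \<open>d \<le> h\<close> \<open>q \<ge> 0\<close> exp_ge_add_one_self[of q]
      by (intro mult_left_mono) (auto simp: exp_minus field_simps)
    also have "\<dots> = 2 * h\<^sup>2 * (h + b) / (2 * D + h\<^sup>2 * b\<^sup>2)"
    proof -
      have "1 + q = (2 * D + h\<^sup>2 * b\<^sup>2) / (2 * D)" using D by (simp add: q_def add_divide_distrib)
      then show ?thesis unfolding hd using D by simp
    qed
    also have "\<dots> \<le> 0.23"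
    proof -
      have "2 * h\<^sup>2 * (h + b) \<le> 2 * h\<^sup>2 * (5/4 * b)"
        using assms by (intro mult_left_mono) auto
      also have "\<dots> = 2.5 * h * (h * b)" by (simp add: power2_eq_square)
      also have "\<dots> \<le> 2.5 * h * (b * b / 4)"
        using assms by (intro mult_left_mono) auto
      also have "\<dots> \<le> 0.23 * (2 + h\<^sup>2) * b\<^sup>2"
      proof -
        \<comment> \<open>125/92 is the vertex of \<open>0.23 * (2 + h\<^sup>2) - 0.625 * h\<close>,
          which is positive there because the square of 125/92 is below 2.\<close>
        have "0 \<le> (h - 125 / 92)\<^sup>2" by simp
        then have "0.625 * h \<le> 0.23 * (2 + h\<^sup>2)" by (simp add: power2_eq_square algebra_simps)
        from mult_right_mono[OF this, of "b\<^sup>2"] show ?thesis by (simp add: power2_eq_square)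
      qed
      also have "\<dots> \<le> 0.23 * (2 * D + h\<^sup>2 * b\<^sup>2)" using D by (simp add: algebra_simps)
      finally show ?thesis using D by (simp add: divide_le_eq add_pos_nonneg)
    qed
    finally show ?thesis .
  qed
  moreover have "integral {- d..b} (chord_weight h b) \<le> 0.86 * sqrt pi"
  proof -
    have "integral {- d..b} (chord_weight h b) \<le> integral {- d..b} (\<lambda>s. exp (- (c * (s + d))\<^sup>2))"
      using \<open>q \<ge> 0\<close>
      by (intro integral_le int integrable_continuous_interval continuous_intros) (auto simp: weight mult_left_le)
    also have "\<dots> \<le> sqrt pi / (2 * c)"
      using c(1) \<open>0 \<le> d\<close> assms by (intro integral_half_gaussian_le) auto
    also have "\<dots> \<le> 0.86 * sqrt pi"
    proof -
      \<comment> \<open>The factor \<open>1 / (2 * c) = (h + b) / sqrt (2 * D)\<close> is largest at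
        \<open>b = 4 * h\<close>, where it is \<open>5 / sqrt 34\<close>, just below 0.86. The
        constants 1.4792 and 1.72 are \<open>2 * 0.86\<^sup>2\<close> and
        \<open>2 * 0.86\<close>.\<close>
      have "0 \<le> (b - 4 * h) * (4 * b - h)" using assms by (intro mult_nonneg_nonneg) auto
      then have "17 * (h * b) \<le> 4 * D" by (simp add: D_def power2_eq_square algebra_simps)
      moreover have "(h + b)\<^sup>2 = D + 2 * (h * b)" by (simp add: D_def power2_eq_square algebra_simps)
      ultimately have "(h + b)\<^sup>2 \<le> 1.4792 * D" using D(1) by simp
      then have "(1 / 1.72)\<^sup>2 \<le> c\<^sup>2" unfolding c(2) using hb
        by (subst pos_le_divide_eq) (simp_all add: power_divide)
      then have "1 / 1.72 \<le> c" by (rule power2_le_imp_le) (use c(1) in simp)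
      then have "1 / (2 * c) \<le> 0.86" using c(1) by (simp add: field_simps)
      from mult_right_mono[OF this, of "sqrt pi"] show ?thesis by simp
    qed
    finally show ?thesis .
  qed
  \<comment> \<open>The remaining share \<open>0.14 * sqrt pi\<close> is then at least 0.245, more
    than the 0.23 of the left part.\<close>
  moreover have "7 / 4 \<le> sqrt pi"
    using pi_approx(1) by (intro real_le_rsqrt) (simp add: power2_eq_square)
  ultimately show ?thesis by simp
qed

text \<open>Here the scale-invariant bound of \<open>exp_minus_quarter_le\<close> integrates to
  \<open>ln ((1 + y) / (1 - y)) / (y * sqrt (exp 1))\<close>, where \<open>y = sqrt (h\<^sup>2 + b\<^sup>2) / (h + b)\<close>.\<close>

lemma integral_chord_weight_balanced:
  assumes "0 < h" "0 < b" "b \<le> 4 * h" "h \<le> 4 * b"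
  shows "integral {- h..b} (chord_weight h b) \<le> sqrt pi"
proof -
  define N where "N = sqrt (h\<^sup>2 + b\<^sup>2)"
  define m where "m = (b - h) / (b + h)"
  define k where "k = 2 * h * b / (b + h)"
  define M where "M = sqrt (1 + m\<^sup>2)"
  define L where "L s = M\<^sup>2 * s + m * k + M * sqrt (s\<^sup>2 + (k + m * s)\<^sup>2)" for s
  define y where "y = N / (h + b)"
  have pos: "h + b > 0" "N > 0" "y > 0" using assms by (auto simp: N_def y_def add_pos_pos)
  have N2: "N\<^sup>2 = h\<^sup>2 + b\<^sup>2" by (simp add: N_def)
  have "h < N" unfolding N_def using assms by (intro real_less_rsqrt) auto
  have chord: "chord h b s = k + m * s" for s
    by (simp add: chord_def k_def m_def add_divide_distrib)
  have "k > 0" using assms by (simp add: k_def)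
  \<comment> \<open>The end points \<open>(b, 0)\<close> and \<open>(0, h)\<close> have coordinates
    \<open>(b, b)\<close> and \<open>(- h, h)\<close> in \<open>(s, u)\<close>, so the square root
    in \<open>L\<close> collapses to \<open>sqrt 2\<close> times \<open>b\<close> or
    \<open>h\<close>.\<close>
  have ends: "k + m * b = b" "k + m * (- h) = h"
  proof -
    have "k + m * b = b * (h + b) / (b + h)" "k + m * (- h) = h * (h + b) / (b + h)"
      unfolding k_def m_def times_divide_eq_left add_divide_distrib[symmetric]
      by (simp_all add: algebra_simps)
    then show "k + m * b = b" "k + m * (- h) = h" using pos by (simp_all add: add.commute)
  qed
  have M2: "M\<^sup>2 = 2 * N\<^sup>2 / (h + b)\<^sup>2"
    using pos unfolding N2 M_def by (simp add: m_def power_divide add_pos_nonneg field_simps) (simp add: power2_eq_square algebra_simps)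
  have M: "M = sqrt 2 * y"
  proof -
    have "M\<^sup>2 = (sqrt 2 * y)\<^sup>2" by (simp add: M2 y_def power_mult_distrib power_divide)
    moreover have "M \<ge> 0" by (simp add: M_def)
    ultimately show ?thesis using pos by (simp add: power2_eq_iff_nonneg)
  qed
  have mk: "m * k = 2 * h * b * (b - h) / (h + b)\<^sup>2"
    by (simp add: m_def k_def power2_eq_square add.commute)
  have Lb: "L b = 2 * b * (N + b) / (h + b)"
  proof -
    have "L b = M\<^sup>2 * b + m * k + 2 * y * b"
      using assms unfolding L_def ends by (simp add: M real_sqrt_mult)
    also have "\<dots> = (2 * N\<^sup>2 * b + 2 * h * b * (b - h) + 2 * N * b * (h + b)) / (h + b)\<^sup>2"
      using pos unfolding M2 mk y_def by (simp add: add_divide_distrib power2_eq_square)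
    also have "\<dots> = 2 * b * (N + b) / (h + b)"
      using pos unfolding N2 by (simp add: field_simps) (simp add: power2_eq_square algebra_simps)
    finally show ?thesis .
  qed
  have Lh: "L (- h) = 2 * h * (N - h) / (h + b)"
  proof -
    have "L (- h) = M\<^sup>2 * (- h) + m * k + 2 * y * h"
      using assms unfolding L_def ends by (simp add: M real_sqrt_mult)
    also have "\<dots> = (- 2 * N\<^sup>2 * h + 2 * h * b * (b - h) + 2 * N * h * (h + b)) / (h + b)\<^sup>2"
      using pos unfolding M2 mk y_def by (simp add: add_divide_distrib diff_divide_distrib power2_eq_square)
    also have "\<dots> = 2 * h * (N - h) / (h + b)"
      using pos unfolding N2 by (simp add: field_simps) (simp add: power2_eq_square algebra_simps)
    finally show ?thesis .
  qed
  \<comment> \<open>The worst ratio 1:4 gives \<open>sqrt 17 / 5\<close>, about 0.825.\<close>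
  have y: "y \<le> 5 / 6"
  proof -
    have "0 \<le> (4 * h - b) * (4 * b - h)" using assms by (intro mult_nonneg_nonneg) auto
    moreover have "0 < h * b" using assms by simp
    ultimately have "36 * N\<^sup>2 \<le> 25 * (h + b)\<^sup>2" unfolding N2 by (simp add: power2_eq_square algebra_simps)
    then have "(6 * N)\<^sup>2 \<le> (5 * (h + b))\<^sup>2" unfolding power_mult_distrib by simp
    then have "6 * N \<le> 5 * (h + b)" using pos by (auto intro: power2_le_imp_le)
    then show ?thesis using pos by (simp add: y_def field_simps)
  qed
  have ratio: "L b / L (- h) = (1 + y) / (1 - y)"
  proof -
    have "L b / L (- h) = b * (N + b) / (h * (N - h))"
      using pos unfolding Lb Lh by (simp add: mult.assoc)
    also have "\<dots> = (h + b + N) / (h + b - N)"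
    proof -
      have "N < h + b" using y pos by (simp add: y_def field_simps)
      moreover have "b * (N + b) * (h + b - N) = (h + b + N) * (h * (N - h))"
        using N2 by algebra
      ultimately show ?thesis using assms \<open>h < N\<close> by (simp add: frac_eq_eq)
    qed
    also have "\<dots> = (1 + y) / (1 - y)"
    proof -
      have "1 + y = (h + b + N) / (h + b)" "1 - y = (h + b - N) / (h + b)"
        using pos by (simp_all add: y_def field_simps)
      then show ?thesis using pos by simp
    qed
    finally show ?thesis .
  qed
  have I: "((\<lambda>s. 1 / sqrt (s\<^sup>2 + (k + m * s)\<^sup>2)) has_integral (ln (L b / L (- h)) / M)) {- h..b}"
    unfolding L_def M_def using \<open>k > 0\<close> assms by (intro has_integral_inverse_sqrt_quadratic) auto
  have J: "((\<lambda>s. sqrt (2 / exp 1) * (1 / sqrt (s\<^sup>2 + (k + m * s)\<^sup>2))) has_integral (sqrt (2 / exp 1) * (ln (L b / L (- h)) / M))) {- h..b}"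
    by (rule has_integral_mult_right[OF I])
  have "integral {- h..b} (chord_weight h b) \<le> sqrt (2 / exp 1) * (ln (L b / L (- h)) / M)"
  proof (rule has_integral_le[OF integrable_integral J])
    show "chord_weight h b integrable_on {- h..b}"
      by (intro integrable_continuous_interval continuous_on_chord_weight)
    fix s
    have "0 < s\<^sup>2 + (k + m * s)\<^sup>2" using \<open>k > 0\<close> by (cases "s = 0") (auto simp: add_pos_nonneg)
    from exp_minus_quarter_le[OF this]
    show "chord_weight h b s \<le> sqrt (2 / exp 1) * (1 / sqrt (s\<^sup>2 + (k + m * s)\<^sup>2))"
      unfolding chord_weight_def chord by simp
  qed
  also have "\<dots> \<le> sqrt (2 / exp 1) * (2.9 * y / M)"
    unfolding ratio using ln_ratio_le[OF pos(3) y] pos M by (intro mult_left_mono divide_right_mono) auto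
  \<comment> \<open>As \<open>M = sqrt 2 * y\<close>, the linear bound on the logarithm cancels
    \<open>y\<close> and leaves a pure constant.\<close>
  also have "\<dots> = 2.9 / sqrt (exp 1)"
    unfolding M using pos by (simp add: real_sqrt_divide)
  also have "\<dots> \<le> sqrt pi"
  proof -
    have e: "2.71 \<le> (exp 1 :: real)" using e_approx_32 by (simp add: abs_if split: if_splits)
    have "2.9\<^sup>2 \<le> 3.14 * (2.71 :: real)" by (simp add: power2_eq_square)
    also have "\<dots> \<le> pi * exp 1" using e pi_approx(1) by (intro mult_mono) auto
    finally have "2.9 \<le> sqrt (pi * exp 1)" by (rule real_le_rsqrt)
    then show ?thesis by (simp add: real_sqrt_mult field_simps)
  qed
  finally show ?thesis .
qed

text \<open>Exchanging the two axes negates \<open>s\<close>, fixes \<open>u\<close> and swaps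
  \<open>h\<close> with \<open>b\<close>.\<close>

lemma integral_chord_weight_commute:
  "integral {- h..b} (chord_weight h b) = integral {- b..h} (chord_weight b h)"
proof -
  have "chord_weight h b (- s) = chord_weight b h s" for s
    by (simp add: chord_weight_def chord_def algebra_simps)
  then show ?thesis
    using Henstock_Kurzweil_Integration.integral_reflect_real[of b "- h" "chord_weight h b"] by simp
qed

proposition integral_chord_weight_le:
  assumes "0 \<le> h" "0 < b"
  shows "integral {- h..b} (chord_weight h b) \<le> sqrt pi"
proof -
  consider "4 * h \<le> b" | "4 * b \<le> h" | "0 < h" "b \<le> 4 * h" "h \<le> 4 * b"
    using assms by linarith
  then show ?thesis
  proof cases
    case 2
    then show ?thesis
      using assms integral_chord_weight_steep[of b h] by (simp add: integral_chord_weight_commute[of h])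
  qed (use assms integral_chord_weight_steep integral_chord_weight_balanced in auto)
qed

section \<open>The four boundary arcs\<close>

text \<open>The graph of the decreasing function \<open>f\<close> over \<open>{0..b}\<close>, completed by the vertical segments at
  its jumps; a concave \<open>f\<close> may jump at \<open>b\<close>.\<close>

definition descending_arc :: "(real \<Rightarrow> real) \<Rightarrow> real \<Rightarrow> (real \<times> real) set" where
  "descending_arc f b = {(x, y). x \<in> {0..b} \<and> y \<in> {0..f 0} \<and>
     (\<forall>t\<in>{0..b}. (x < t \<longrightarrow> f t \<le> y) \<and> (t < x \<longrightarrow> y \<le> f t))}"

text \<open>An implication with a strict premise is a union of two closed half-planes, so the arc is
  closed for arbitrary \<open>f\<close>. This supplies Borel measurability.\<close>

lemma closed_descending_arc: "closed (descending_arc f b)"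
proof -
  have eq: "descending_arc f b = ({0..b} \<times> {0..f 0}) \<inter>
      (\<Inter>t\<in>{0..b}. ({p. t \<le> fst p} \<union> {p. f t \<le> snd p}) \<inter> ({p. fst p \<le> t} \<union> {p. snd p \<le> f t}))"
    by (auto simp: descending_arc_def imp_conv_disj not_less)
  show ?thesis
    unfolding eq
    by (intro closed_Int closed_INT closed_Un ballI closed_Times closed_atLeastAtMost closed_Collect_le continuous_intros)
qed

text \<open>The value of \<open>f\<close> midway between two abscissas separates the ordinates. The
  product form also allows vertical segments, and it is the sign condition that makes
  \<open>x - y\<close> expansive.\<close>

lemma descending_arc_antitone:
  assumes "(x, y) \<in> descending_arc f b" "(x', y') \<in> descending_arc f b"
  shows "(x - x') * (y - y') \<le> 0"
proof -
  have *: "v' \<le> v" if "(u, v) \<in> descending_arc f b" "(u', v') \<in> descending_arc f b" "u < u'" for u v u' v'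
  proof -
    define t where "t = (u + u') / 2"
    have "u < t" "t < u'" "t \<in> {0..b}"
      using that by (auto simp: t_def descending_arc_def)
    then have "f t \<le> v" "v' \<le> f t" using that by (auto simp: descending_arc_def)
    then show ?thesis by simp
  qed
  show ?thesis
    using *[OF assms] *[OF assms(2,1)]
    by (cases x x' rule: linorder_cases) (auto simp: mult_nonpos_nonneg mult_nonneg_nonpos mult_le_0_iff)
qed

text \<open>Membership compares \<open>y\<close> only with values of \<open>f\<close> at parameters
  other than \<open>x\<close>, so concavity is used slightly to the right of \<open>x\<close>,
  followed by a limit.\<close>

lemma descending_arc_above_chord:
  assumes "0 < b" "concave_on {0..b} f" "f b = 0" and p: "(x, y) \<in> descending_arc f b"
  shows "f 0 * (b - x) \<le> b * y"
proof (cases "x < b")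
  case True
  have "x \<ge> 0" "y \<ge> 0" using p by (auto simp: descending_arc_def)
  have "f 0 * (b - t) \<le> b * y" if "x < t" "t < b" for t
  proof -
    have "(1 - t / b) * f 0 + t / b * f b \<le> f ((1 - t / b) *\<^sub>R 0 + (t / b) *\<^sub>R b)"
      using that \<open>x \<ge> 0\<close> assms(1,2) by (intro concave_onD[of "{0..b}"]) auto
    then have "(1 - t / b) * f 0 \<le> f t" using assms by simp
    also have "\<dots> \<le> y" using p that \<open>x \<ge> 0\<close> by (auto simp: descending_arc_def)
    finally show ?thesis using assms(1) by (simp add: field_simps)
  qed
  then have "\<forall>\<^sub>F t in at_right x. f 0 * (b - t) \<le> b * y"
    using True unfolding eventually_at_right_field by blast
  moreover have "((\<lambda>t. f 0 * (b - t)) \<longlongrightarrow> f 0 * (b - x)) (at_right x)"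
    by (intro tendsto_intros)
  ultimately show ?thesis by (intro tendsto_upperbound) auto
next
  case False
  then show ?thesis using p assms(1) by (auto simp: descending_arc_def)
qed

text \<open>The signs \<sigma> and \<tau> place the arc in any quadrant without changing norms or
  distances. Expansiveness is \<open>(X - Y)\<^sup>2 = X\<^sup>2 + Y\<^sup>2 - 2 * X * Y\<close>
  with \<open>X * Y \<le> 0\<close>.\<close>

lemma nn_integral_descending_arc_le:
  assumes b: "0 < b" and conc: "concave_on {0..b} f" and f: "f b = 0" "0 \<le> f 0"
    and \<sigma>: "\<sigma>\<^sup>2 = 1" "\<tau>\<^sup>2 = 1"
  shows "(\<integral>\<^sup>+ p \<in> {p. (\<sigma> * fst p, \<tau> * snd p) \<in> descending_arc f b}. ennreal (exp (- (norm p)\<^sup>2 / 2)) \<partial>hausdorff1)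
    \<le> ennreal (sqrt pi)" (is "nn_integral _ (\<lambda>p. _ * indicator ?A p) \<le> _")
proof -
  define T where "T p = \<sigma> * fst p - \<tau> * snd p" for p :: "real \<times> real"
  define h where "h = f 0"
  have "h \<ge> 0" using f by (simp add: h_def)
  have T_cont: "continuous_on UNIV T" unfolding T_def by (intro continuous_intros)
  have "closed ?A"
  proof -
    have "?A = (\<lambda>p. (\<sigma> * fst p, \<tau> * snd p)) -` descending_arc f b" by auto
    then show ?thesis
      using closed_descending_arc by (auto intro!: closed_vimage continuous_intros)
  qed
  have "(\<integral>\<^sup>+ p \<in> ?A. ennreal (exp (- (norm p)\<^sup>2 / 2)) \<partial>hausdorff1) \<le> ennreal (integral {- h..b} (chord_weight h b))"
  proof (rule nn_integral_hausdorff1_le_integral[where T = T])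
    show "?A \<in> sets borel" using \<open>closed ?A\<close> by simp
    show "T \<in> borel_measurable borel" by (intro borel_measurable_continuous_onI T_cont)
    show "- h \<le> b" using \<open>h \<ge> 0\<close> b by simp
    show "T ` ?A \<subseteq> {- h..b}" by (auto simp: T_def h_def descending_arc_def)
    show "continuous_on {- h..b} (chord_weight h b)" by (rule continuous_on_chord_weight)
    show "0 \<le> chord_weight h b t" for t by (simp add: chord_weight_def)
  next
    fix p q assume pq: "p \<in> ?A" "q \<in> ?A"
    define X Y where "X = \<sigma> * (fst p - fst q)" and "Y = \<tau> * (snd p - snd q)"
    have "X * Y \<le> 0"
      using pq descending_arc_antitone by (force simp: X_def Y_def right_diff_distrib)
    moreover have "(dist p q)\<^sup>2 = X\<^sup>2 + Y\<^sup>2"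
      by (simp add: X_def Y_def dist_prod_def dist_real_def power_mult_distrib \<sigma>)
    moreover have "T p - T q = X - Y"
      by (simp add: T_def X_def Y_def algebra_simps)
    ultimately have "(dist p q)\<^sup>2 \<le> (T p - T q)\<^sup>2"
      by (simp add: power2_diff)
    then show "dist p q \<le> \<bar>T p - T q\<bar>" by (simp add: abs_le_square_iff[symmetric])
  next
    fix p assume "p \<in> ?A"
    define x y where "x = \<sigma> * fst p" and "y = \<tau> * snd p"
    have xy: "(x, y) \<in> descending_arc f b" using \<open>p \<in> ?A\<close> by (simp add: x_def y_def)
    then have "0 \<le> x" "0 \<le> y" "x \<le> b" by (auto simp: descending_arc_def)
    have "2 * h * b + (b - h) * (x - y) = 2 * h * (b - x) - 2 * b * y + (b + h) * (x + y)"
      by (simp add: algebra_simps)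
    also have "\<dots> \<le> (b + h) * (x + y)"
      using descending_arc_above_chord[OF b conc f(1) xy] by (simp add: h_def algebra_simps)
    finally have "chord h b (x - y) \<le> x + y"
      using b \<open>h \<ge> 0\<close> by (simp add: chord_def field_simps)
    \<comment> \<open>The chord lies below \<open>x + y\<close>; comparing squares also needs its
      sign.\<close>
    moreover have "0 \<le> chord h b (x - y)"
    proof -
      have "0 \<le> h * (b - x) + b * x + (f 0 - y) * b + h * y"
        using xy b \<open>h \<ge> 0\<close> by (intro add_nonneg_nonneg mult_nonneg_nonneg) (auto simp: descending_arc_def)
      then show ?thesis using b \<open>h \<ge> 0\<close> by (simp add: chord_def h_def algebra_simps)
    qed
    ultimately have "(chord h b (x - y))\<^sup>2 \<le> (x + y)\<^sup>2" by (intro power_mono)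
    moreover have "(norm p)\<^sup>2 = x\<^sup>2 + y\<^sup>2"
      by (simp add: norm_prod_def x_def y_def power_mult_distrib \<sigma>)
    ultimately have "(x - y)\<^sup>2 + (chord h b (x - y))\<^sup>2 \<le> 2 * (norm p)\<^sup>2"
      by (simp add: power2_eq_square algebra_simps)
    then show "exp (- (norm p)\<^sup>2 / 2) \<le> chord_weight h b (T p)"
      by (simp add: chord_weight_def T_def flip: x_def y_def)
  qed
  also have "\<dots> \<le> ennreal (sqrt pi)"
    by (intro ennreal_leI integral_chord_weight_le \<open>h \<ge> 0\<close> b)
  finally show ?thesis .
qed

section \<open>Locating the frontier of the region\<close>

lemma concave_antimono_right_of_max:
  fixes f :: "real \<Rightarrow> real"
  assumes "concave_on {a..b} f" "a \<le> 0" "\<forall>x\<in>{a..b}. f x \<le> f 0" "0 \<le> s" "s \<le> t" "t \<le> b"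
  shows "f t \<le> f s"
proof (cases "t = 0")
  case False
  then have "t > 0" using assms by simp
  have "(1 - s / t) * f 0 + s / t * f t \<le> f ((1 - s / t) *\<^sub>R 0 + (s / t) *\<^sub>R t)"
    using assms \<open>t > 0\<close> by (intro concave_onD[OF assms(1)]) auto
  moreover have "(1 - s / t) * f t \<le> (1 - s / t) * f 0"
    using assms \<open>t > 0\<close> by (intro mult_left_mono) auto
  ultimately show ?thesis using \<open>t > 0\<close> by (simp add: algebra_simps)
qed (use assms in simp)

text \<open>The gap below \<open>f t\<close> survives small perturbations: between 0 and
  \<open>t\<close> the function stays above \<open>f t\<close>, and left of 0 it stays above the
  segment from \<open>(a, 0)\<close> to \<open>(0, f 0)\<close>. This yields interior points of the
  region.\<close>

lemma concave_room_below_graph: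
  fixes f :: "real \<Rightarrow> real"
  assumes "a < 0" and conc: "concave_on {a..b} f" and "f a = 0"
    and max: "\<forall>x\<in>{a..b}. f x \<le> f 0"
    and "0 \<le> x" "x < t" "t \<le> b" "0 \<le> y" "y < f t"
  obtains e where "0 < e" "\<And>u v. \<bar>u - x\<bar> < e \<Longrightarrow> \<bar>v - y\<bar> < e \<Longrightarrow> u \<in> {a..b} \<and> v \<le> f u"
proof
  define c where "c = (y + f t) / 2"
  have "f t \<le> f 0" using max assms by simp
  have f0: "f 0 > 0" "c < f 0" "y < c" "c < f t" 
    using \<open>0 \<le> y\<close> \<open>y < f t\<close> \<open>f t \<le> f 0\<close> by (simp_all add: c_def)
  \<comment> \<open>The entries keep \<open>u\<close> below \<open>t\<close>, \<open>v\<close> below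
    \<open>c\<close>, \<open>u\<close> above \<open>a\<close>, and the left segment above
    \<open>c\<close>.\<close>
  define e where "e = Min {t - x, c - y, - a, (f 0 - c) * (- a) / f 0}"
  have e: "e \<le> t - x" "e \<le> c - y" "e \<le> - a" "e \<le> (f 0 - c) * (- a) / f 0" by (simp_all add: e_def)
  have "0 < (f 0 - c) * (- a) / f 0" using f0 assms by (intro divide_pos_pos mult_pos_pos) auto
  then show "0 < e" unfolding e_def using assms f0 by simp
  show "u \<in> {a..b} \<and> v \<le> f u" if "\<bar>u - x\<bar> < e" "\<bar>v - y\<bar> < e" for u v
  proof
    show u: "u \<in> {a..b}" using that e assms by auto
    have "v \<le> c" using that e by linarith
    also have "c \<le> f u"
    proof (cases "u \<ge> 0")
      case True
      then have "f t \<le> f u"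
        using that e assms by (intro concave_antimono_right_of_max[OF conc _ max]) auto
      then show ?thesis using f0 by simp
    next
      case False
      have "- u < e" using that assms False by linarith
      then have "- u \<le> (f 0 - c) * (- a) / f 0" using e by linarith
      then have "c \<le> (1 - u / a) * f 0" using f0 assms(1) by (simp add: field_simps)
      also have "\<dots> \<le> f ((1 - u / a) *\<^sub>R 0 + (u / a) *\<^sub>R a)"
        using concave_onD[OF conc, of "u / a" 0 a] assms False u by (simp add: field_simps)
      finally show ?thesis using assms(1) by simp
    qed
    finally show "v \<le> f u" .
  qed
qed

definition region :: "real \<Rightarrow> real \<Rightarrow> (real \<Rightarrow> real) \<Rightarrow> (real \<Rightarrow> real) \<Rightarrow> (real \<times> real) set" where
  "region a b f g = {(x, y). x \<in> {a..b} \<and> - g x \<le> y \<and> y \<le> f x}"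

text \<open>Each conclusion is a closed condition that holds on the region, hence on its closure. In
  the last one, \<open>fst p \<le> t\<close> is kept as an alternative to make the condition
  closed.\<close>

lemma closure_region_right_half:
  assumes "a < 0" "concave_on {a..b} f" "concave_on {a..b} g"
    and max: "\<forall>x\<in>{a..b}. f x \<le> f 0" "\<forall>x\<in>{a..b}. g x \<le> g 0"
    and p: "(x, y) \<in> closure (region a b f g)"
  shows "x \<le> b" "y \<le> f 0" "- y \<le> g 0"
    and "\<And>t. t \<in> {0..b} \<Longrightarrow> t < x \<Longrightarrow> y \<le> f t \<and> - y \<le> g t"
proof -
  have "region a b f g \<subseteq> {a..b} \<times> {- g 0..f 0}"
    using max by (force simp: region_def)
  then have "closure (region a b f g) \<subseteq> {a..b} \<times> {- g 0..f 0}"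
    by (rule closure_minimal) (intro closed_Times closed_atLeastAtMost)
  then show "x \<le> b" "y \<le> f 0" "- y \<le> g 0" using p by auto
  fix t assume t: "t \<in> {0..b}" "t < x"
  have "region a b f g \<subseteq> {p. fst p \<le> t} \<union> ({p. snd p \<le> f t} \<inter> {p. - g t \<le> snd p})"
  proof
    fix p assume p: "p \<in> region a b f g"
    then obtain u v where uv: "p = (u, v)" "u \<in> {a..b}" "- g u \<le> v" "v \<le> f u" by (auto simp: region_def)
    show "p \<in> {p. fst p \<le> t} \<union> ({p. snd p \<le> f t} \<inter> {p. - g t \<le> snd p})"
    proof (cases "u \<le> t")
      case False
      have "f u \<le> f t"
        by (rule concave_antimono_right_of_max[OF assms(2) _ max(1)]) (use False t uv assms(1) in auto)
      moreover have "g u \<le> g t"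
        by (rule concave_antimono_right_of_max[OF assms(3) _ max(2)]) (use False t uv assms(1) in auto)
      ultimately show ?thesis using uv by simp
    qed (use uv in simp)
  qed
  then have "closure (region a b f g) \<subseteq> {p. fst p \<le> t} \<union> ({p. snd p \<le> f t} \<inter> {p. - g t \<le> snd p})"
    by (rule closure_minimal) (intro closed_Un closed_Int closed_Collect_le continuous_intros)
  then show "y \<le> f t \<and> - y \<le> g t" using p t by force
qed

text \<open>The closure already provides the clauses with \<open>t < x\<close>, so a point on
  neither arc fails a clause with \<open>x < t\<close>. That leaves room below \<open>f\<close> if
  \<open>0 \<le> y\<close> and room above \<open>- g\<close> if \<open>y \<le> 0\<close>, which
  makes the point interior.\<close>

lemma frontier_region_right_half:
  assumes ab: "a < 0" "0 < b" and conc: "concave_on {a..b} f" "concave_on {a..b} g"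
    and nonneg: "\<forall>x\<in>{a..b}. 0 \<le> f x" "\<forall>x\<in>{a..b}. 0 \<le> g x"
    and ends: "f a = 0" "g a = 0"
    and max: "\<forall>x\<in>{a..b}. f x \<le> f 0" "\<forall>x\<in>{a..b}. g x \<le> g 0"
    and p: "(x, y) \<in> frontier (region a b f g)" and "0 \<le> x"
  shows "(x, y) \<in> descending_arc f b \<or> (x, - y) \<in> descending_arc g b"
proof (rule ccontr)
  assume no: "\<not> ?thesis"
  note cl = closure_region_right_half[OF ab(1) conc max, of x y]
  have closure: "(x, y) \<in> closure (region a b f g)" using p by (simp add: frontier_def)
  have room_f: "\<exists>e>0. \<forall>u v. \<bar>u - x\<bar> < e \<longrightarrow> \<bar>v - y\<bar> < e \<longrightarrow> u \<in> {a..b} \<and> v \<le> f u" if nonneg_y: "0 \<le> y"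
  proof -
    have "\<exists>t\<in>{0..b}. \<not> ((x < t \<longrightarrow> f t \<le> y) \<and> (t < x \<longrightarrow> y \<le> f t))"
      using no nonneg_y cl(1,2)[OF closure] \<open>0 \<le> x\<close> by (simp add: descending_arc_def)
    then obtain t where t: "t \<in> {0..b}" "x < t" "y < f t"
      using cl(4)[OF closure] by (meson not_le)
    then have "t \<le> b" by simp
    obtain e where "e > 0" "\<And>u v. \<bar>u - x\<bar> < e \<Longrightarrow> \<bar>v - (y)\<bar> < e \<Longrightarrow> u \<in> {a..b} \<and> v \<le> f u"
      by (rule concave_room_below_graph[OF ab(1) conc(1) ends(1) max(1) \<open>0 \<le> x\<close> t(2) \<open>t \<le> b\<close> nonneg_y t(3)]) blast
    then show ?thesis by blast
  qed
  have room_g: "\<exists>e>0. \<forall>u v. \<bar>u - x\<bar> < e \<longrightarrow> \<bar>v - (- y)\<bar> < e \<longrightarrow> u \<in> {a..b} \<and> v \<le> g u" if nonneg_y: "0 \<le> - y"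
  proof -
    have "\<exists>t\<in>{0..b}. \<not> ((x < t \<longrightarrow> g t \<le> - y) \<and> (t < x \<longrightarrow> - y \<le> g t))"
      using no nonneg_y cl(1,3)[OF closure] \<open>0 \<le> x\<close> by (simp add: descending_arc_def)
    then obtain t where t: "t \<in> {0..b}" "x < t" "- y < g t"
      using cl(4)[OF closure] by (meson not_le)
    then have "t \<le> b" by simp
    obtain e where "e > 0" "\<And>u v. \<bar>u - x\<bar> < e \<Longrightarrow> \<bar>v - (- y)\<bar> < e \<Longrightarrow> u \<in> {a..b} \<and> v \<le> g u"
      by (rule concave_room_below_graph[OF ab(1) conc(2) ends(2) max(2) \<open>0 \<le> x\<close> t(2) \<open>t \<le> b\<close> nonneg_y t(3)]) blast
    then show ?thesis by blast
  qed
  have "\<exists>e>0. \<forall>u v. \<bar>u - x\<bar> < e \<longrightarrow> \<bar>v - y\<bar> < e \<longrightarrow> (u, v) \<in> region a b f g"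
  proof (cases y "0::real" rule: linorder_cases)
    case less
    then obtain e where "e > 0" and e: "\<And>u v. \<bar>u - x\<bar> < e \<Longrightarrow> \<bar>v - (- y)\<bar> < e \<Longrightarrow> u \<in> {a..b} \<and> v \<le> g u"
      using room_g by auto
    \<comment> \<open>The radius \<open>- y\<close> keeps \<open>v\<close> negative, so the bound by
      \<open>f\<close> follows from its nonnegativity.\<close>
    have "(u, v) \<in> region a b f g" if "\<bar>u - x\<bar> < min e (- y)" "\<bar>v - y\<bar> < min e (- y)" for u v
    proof -
      have "u \<in> {a..b}" "- v \<le> g u" using e[of u "- v"] that by auto
      moreover have "v \<le> f u" using nonneg(1) that \<open>u \<in> {a..b}\<close> by fastforce
      ultimately show ?thesis by (simp add: region_def)
    qed
    then show ?thesis using \<open>e > 0\<close> less by (intro exI[of _ "min e (- y)"]) auto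
  next
    case equal
    then obtain e e' where "e > 0" "e' > 0"
      and e: "\<And>u v. \<bar>u - x\<bar> < e \<Longrightarrow> \<bar>v - y\<bar> < e \<Longrightarrow> u \<in> {a..b} \<and> v \<le> f u"
      and e': "\<And>u v. \<bar>u - x\<bar> < e' \<Longrightarrow> \<bar>v - (- y)\<bar> < e' \<Longrightarrow> u \<in> {a..b} \<and> v \<le> g u"
      using room_f room_g by auto
    have "(u, v) \<in> region a b f g" if "\<bar>u - x\<bar> < min e e'" "\<bar>v - y\<bar> < min e e'" for u v
    proof -
      have "u \<in> {a..b}" "v \<le> f u" using e[of u v] that by auto
      moreover have "- v \<le> g u" using e'[of u "- v"] that by auto
      ultimately show ?thesis by (simp add: region_def)
    qed
    then show ?thesis using \<open>e > 0\<close> \<open>e' > 0\<close> by (intro exI[of _ "min e e'"]) auto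
  next
    case greater
    then obtain e where "e > 0" and e: "\<And>u v. \<bar>u - x\<bar> < e \<Longrightarrow> \<bar>v - y\<bar> < e \<Longrightarrow> u \<in> {a..b} \<and> v \<le> f u"
      using room_f by auto
    have "(u, v) \<in> region a b f g" if "\<bar>u - x\<bar> < min e y" "\<bar>v - y\<bar> < min e y" for u v
    proof -
      have "u \<in> {a..b}" "v \<le> f u" using e[of u v] that by auto
      moreover have "- g u \<le> v" using nonneg(2) that \<open>u \<in> {a..b}\<close> by fastforce
      ultimately show ?thesis by (simp add: region_def)
    qed
    then show ?thesis using \<open>e > 0\<close> greater by (intro exI[of _ "min e y"]) auto
  qed
  then obtain e where "e > 0" and e: "\<And>u v. \<bar>u - x\<bar> < e \<Longrightarrow> \<bar>v - y\<bar> < e \<Longrightarrow> (u, v) \<in> region a b f g"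
    by blast
  have "ball (x, y) e \<subseteq> region a b f g"
  proof
    fix q assume q: "q \<in> ball (x, y) e"
    have "\<bar>fst q - x\<bar> < e" "\<bar>snd q - y\<bar> < e"
      using q dist_fst_le[of "(x, y)" q] dist_snd_le[of "(x, y)" q]
      by (auto simp: dist_real_def abs_minus_commute)
    then show "q \<in> region a b f g" using e[of "fst q" "snd q"] by simp
  qed
  then have "(x, y) \<in> interior (region a b f g)" using \<open>e > 0\<close> by (auto simp: mem_interior)
  then show False using p by (simp add: frontier_def)
qed

text \<open>Injective linear maps of the plane commute with closure and interior. The left half of
  the frontier thus becomes a right half.\<close>

lemma frontier_region_reflect:
  assumes "(x, y) \<in> frontier (region a b f g)"
  shows "(- x, y) \<in> frontier (region (- b) (- a) (\<lambda>t. f (- t)) (\<lambda>t. g (- t)))"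
proof -
  define \<rho> where "\<rho> p = (- fst p, snd p)" for p :: "real \<times> real"
  have \<rho>: "linear \<rho>" "inj \<rho>" by (auto simp: \<rho>_def linear_iff inj_def prod_eq_iff)
  have img: "\<rho> ` region a b f g = region (- b) (- a) (\<lambda>t. f (- t)) (\<lambda>t. g (- t))"
  proof (intro equalityI subsetI)
    fix p assume "p \<in> region (- b) (- a) (\<lambda>t. f (- t)) (\<lambda>t. g (- t))"
    then have "\<rho> p \<in> region a b f g" "p = \<rho> (\<rho> p)" by (auto simp: \<rho>_def region_def)
    then show "p \<in> \<rho> ` region a b f g" by blast
  qed (auto simp: \<rho>_def region_def)
  have "frontier (\<rho> ` region a b f g) = \<rho> ` frontier (region a b f g)"
    unfolding frontier_def
    by (simp add: closure_injective_linear_image[OF \<rho>] interior_injective_linear_image[OF \<rho>] image_set_diff[OF \<rho>(2)])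
  moreover have "(- x, y) = \<rho> (x, y)" by (simp add: \<rho>_def)
  ultimately show ?thesis using assms unfolding img by blast
qed

lemma concave_on_reflect:
  fixes f :: "real \<Rightarrow> real"
  assumes "concave_on {a..b} f"
  shows "concave_on {- b..- a} (\<lambda>t. f (- t))"
  unfolding concave_on_iff
proof (intro conjI ballI allI impI)
  fix x y u v :: real
  assume "x \<in> {- b..- a}" "y \<in> {- b..- a}" "0 \<le> u" "0 \<le> v" "u + v = 1"
  moreover have "- x \<in> {a..b}" "- y \<in> {a..b}" using calculation by auto
  ultimately have "u * f (- x) + v * f (- y) \<le> f (u *\<^sub>R (- x) + v *\<^sub>R (- y))"
    using assms unfolding concave_on_iff by blast
  then show "u * f (- x) + v * f (- y) \<le> f (- (u *\<^sub>R x + v *\<^sub>R y))" by simp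
qed simp

lemma concave_on_subinterval:
  "concave_on S f \<Longrightarrow> T \<subseteq> S \<Longrightarrow> convex T \<Longrightarrow> concave_on T f"
  unfolding concave_on_def by (rule convex_on_subset)

section \<open>Adding up the four arcs\<close>

theorem theorem1p3:
  fixes a b :: real and f g :: "real \<Rightarrow> real"
  assumes "a < 0" and "0 < b"
    and "concave_on {a..b} f" and "concave_on {a..b} g"
    and "\<forall>x\<in>{a..b}. 0 \<le> f x" and "\<forall>x\<in>{a..b}. 0 \<le> g x"
    and "f a = 0" and "f b = 0" and "g a = 0" and "g b = 0"
    and "\<forall>x\<in>{a..b}. f x \<le> f 0" and "\<forall>x\<in>{a..b}. g x \<le> g 0"
  shows "gaussian_perimeter2 {(x, y). x \<in> {a..b} \<and> - g x \<le> y \<and> y \<le> f x}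
           \<le> ennreal (2 / sqrt pi)"
proof -
  define f' g' where "f' t = f (- t)" and "g' t = g (- t)" for t
  define \<phi> :: "real \<times> real \<Rightarrow> ennreal" where "\<phi> p = ennreal (exp (- (norm p)\<^sup>2 / 2))" for p
  define A where "A \<sigma> \<tau> k c = {p :: real \<times> real. (\<sigma> * fst p, \<tau> * snd p) \<in> descending_arc k c}"
    for \<sigma> \<tau> c :: real and k
  have A_bound: "(\<integral>\<^sup>+ p \<in> A \<sigma> \<tau> k c. \<phi> p \<partial>hausdorff1) \<le> ennreal (sqrt pi)"
    if "0 < c" "concave_on {0..c} k" "k c = 0" "0 \<le> k 0" "\<sigma>\<^sup>2 = 1" "\<tau>\<^sup>2 = 1" for \<sigma> \<tau> c k
    unfolding A_def \<phi>_def using that by (rule nn_integral_descending_arc_le)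
  have A_sets: "A \<sigma> \<tau> k c \<in> sets borel" for \<sigma> \<tau> c k
  proof -
    have "A \<sigma> \<tau> k c = (\<lambda>p. (\<sigma> * fst p, \<tau> * snd p)) -` descending_arc k c" by (auto simp: A_def)
    then have "closed (A \<sigma> \<tau> k c)"
      using closed_descending_arc by (auto intro!: closed_vimage continuous_intros)
    then show ?thesis by simp
  qed
  have f'g': "concave_on {- b..- a} f'" "concave_on {- b..- a} g'"
    unfolding f'_def g'_def using assms concave_on_reflect by blast+
  have conc: "concave_on {0..b} f" "concave_on {0..b} g" "concave_on {0..- a} f'" "concave_on {0..- a} g'"
    using assms by (auto intro: concave_on_subinterval[OF assms(3)] concave_on_subinterval[OF assms(4)]
        concave_on_subinterval[OF f'g'(1)] concave_on_subinterval[OF f'g'(2)])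
  \<comment> \<open>The signs mirror the two axes; the left arcs come from the reflected profiles
    over \<open>{0..- a}\<close>. Overlaps of the arcs only enlarge the sum of indicators.\<close>
  have "frontier (region a b f g) \<subseteq> (A 1 1 f b \<union> A 1 (- 1) g b) \<union> (A (- 1) 1 f' (- a) \<union> A (- 1) (- 1) g' (- a))"
  proof
    fix p assume p: "p \<in> frontier (region a b f g)"
    obtain x y where xy: "p = (x, y)" by fastforce
    show "p \<in> (A 1 1 f b \<union> A 1 (- 1) g b) \<union> (A (- 1) 1 f' (- a) \<union> A (- 1) (- 1) g' (- a))"
    proof (cases "0 \<le> x")
      case True
      then show ?thesis
        using frontier_region_right_half[of a b f g x y] assms p by (auto simp: xy A_def)
    next
      case False
      have "(- x, y) \<in> frontier (region (- b) (- a) f' g')"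
        using frontier_region_reflect p unfolding xy f'_def g'_def by blast
      then have "(- x, y) \<in> descending_arc f' (- a) \<or> (- x, - y) \<in> descending_arc g' (- a)"
        by (rule frontier_region_right_half[rotated -2]) (use assms f'g' False in \<open>auto simp: f'_def g'_def\<close>)
      then show ?thesis by (auto simp: xy A_def)
    qed
  qed
  then have "(\<integral>\<^sup>+ p \<in> frontier (region a b f g). \<phi> p \<partial>hausdorff1)
      \<le> (\<integral>\<^sup>+ p. (\<phi> p * indicator (A 1 1 f b) p + \<phi> p * indicator (A 1 (- 1) g b) p)
          + (\<phi> p * indicator (A (- 1) 1 f' (- a)) p + \<phi> p * indicator (A (- 1) (- 1) g' (- a)) p) \<partial>hausdorff1)"
    by (intro nn_integral_mono) (auto simp: indicator_def)
  also have "\<dots> = (\<integral>\<^sup>+ p \<in> A 1 1 f b. \<phi> p \<partial>hausdorff1) + (\<integral>\<^sup>+ p \<in> A 1 (- 1) g b. \<phi> p \<partial>hausdorff1)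
      + ((\<integral>\<^sup>+ p \<in> A (- 1) 1 f' (- a). \<phi> p \<partial>hausdorff1) + (\<integral>\<^sup>+ p \<in> A (- 1) (- 1) g' (- a). \<phi> p \<partial>hausdorff1))"
  proof -
    have "\<phi> \<in> borel_measurable borel" unfolding \<phi>_def by measurable
    then have [measurable]: "\<phi> \<in> borel_measurable hausdorff1" by simp
    have [measurable]: "A \<sigma> \<tau> k c \<in> sets hausdorff1" for \<sigma> \<tau> c k using A_sets by simp
    show ?thesis by (simp add: nn_integral_add)
  qed
  also have "\<dots> \<le> ennreal (sqrt pi) + ennreal (sqrt pi) + (ennreal (sqrt pi) + ennreal (sqrt pi))"
    using assms conc by (intro add_mono A_bound) (auto simp: f'_def g'_def)
  also have "\<dots> = ennreal (4 * sqrt pi)" by (simp flip: ennreal_plus)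
  finally have "gaussian_perimeter2 (region a b f g) \<le> ennreal (1 / (2 * pi)) * ennreal (4 * sqrt pi)"
    unfolding gaussian_perimeter2_def \<phi>_def by (rule mult_left_mono) simp
  also have "\<dots> = ennreal (1 / (2 * pi) * (4 * sqrt pi))" by (simp flip: ennreal_mult)
  also have "1 / (2 * pi) * (4 * sqrt pi) = 2 / sqrt pi"
    by (simp add: field_simps)
  finally show ?thesis unfolding region_def .
qed

end
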